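(* Let $f:\mathbb{R}^n\to\mathbb{R}$ be smooth, strongly convex with parameters $L\ge\ell>0$, and let $\kappa=L/\ell$. Let $x_k,w_k$ be generated by the Accelerated Gradient (AG) algorithm applied to $f$ from an arbitrary $x_0\in\mathbb{R}^n$, and let $\tilde\sigma_k$ be the auxiliary scalars defined in the context. Then for each $k=0,1,2,\ldots$, $$\tilde\sigma_{k+1}^2\le(1-\kappa^{-1/2})\tilde\sigma_k^2 .$$
   Context: A differentiable convex function $f:\mathbb{R}^n\to\mathbb{R}$ is smooth, strongly convex with parameters $L\ge\ell>0$ if for all $x,y\in\mathbb{R}^n$, $\ \ell\|x-y\|^2/2\le f(y)-f(x)-\nabla f(x)^T(y-x)\le L\|x-y\|^2/2$. Accelerated Gradient (AG): $x_0$ is arbitrary, $w_0:=x_0$; for $k=1,2,\ldots$: $x_k:=w_{k-1}-\nabla f(w_{k-1})/L$ and $w_k:=x_k+\theta(x_k-x_{k-1})$, where $\theta=\dfrac{\sqrt\kappa-1}{\sqrt\kappa+1}$. Auxiliary scalars: $\tilde\sigma_0=\sqrt2\,\|\nabla f(x_0)\|/\ell$ and, for $k=0,1,2,\ldots$, $$\tilde\sigma_{k+1}=\left[(1-\kappa^{-1/2})\tilde\sigma_k^2+\frac{2(f(x_{k+1})-f(w_k))}{\ell}+\frac{\|\nabla f(w_k)\|^2}{L\ell}-(\kappa^{1/2}-\kappa^{-1/2})\|w_k-x_k\|^2\right]^{1/2}.$$ *)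

theory Defs
  imports "HOL-Analysis.Analysis"
begin

definition gradient :: "(real ^ 'n \<Rightarrow> real) \<Rightarrow> real ^ 'n \<Rightarrow> real ^ 'n" where
  "gradient f x = (THE g. GDERIV f x :> g)"

lemma gradient_eqI:
  assumes "GDERIV f x :> g"
  shows "gradient f x = g"
  unfolding gradient_def
proof (rule the_equality)
  fix h assume "GDERIV f x :> h"
  with assms have "(\<lambda>d. d \<bullet> h) = (\<lambda>d. d \<bullet> g)"
    unfolding gderiv_def by (rule has_derivative_unique[rotated])
  then have "\<forall>d. d \<bullet> h = d \<bullet> g"
    by meson
  then show "h = g"
    by (simp only: vector_eq_rdot vector_eq_ldot)
qed (rule assms)

lemma GDERIV_gradient:
  assumes "f differentiable (at x)"
  shows "GDERIV f x :> gradient f x"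
proof -
  from assms obtain D where D: "(f has_derivative D) (at x)"
    by (auto simp: differentiable_def)
  then have "linear D"
    by (rule has_derivative_linear)
  then have "(\<lambda>d. d \<bullet> adjoint D 1) = D"
    using adjoint_works[of D] by auto
  with D have "GDERIV f x :> adjoint D 1"
    by (simp add: gderiv_def)
  then show ?thesis
    using gradient_eqI by metis
qed

definition smooth_strongly_convex :: "(real ^ 'n \<Rightarrow> real) \<Rightarrow> real \<Rightarrow> real \<Rightarrow> bool" where
  "smooth_strongly_convex f L l \<longleftrightarrow>
     0 < l \<and> l \<le> L \<and>
     (\<forall>x. f differentiable (at x)) \<and>
     convex_on UNIV f \<and>
     (\<forall>x y. l * (norm (x - y))\<^sup>2 / 2 \<le> f y - f x - gradient f x \<bullet> (y - x) \<and>
            f y - f x - gradient f x \<bullet> (y - x) \<le> L * (norm (x - y))\<^sup>2 / 2)"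

definition cond_number :: "real \<Rightarrow> real \<Rightarrow> real" where
  "cond_number L l = L / l"

function AG_x AG_w ::
  "(real ^ 'n \<Rightarrow> real) \<Rightarrow> real \<Rightarrow> real \<Rightarrow> real ^ 'n \<Rightarrow> nat \<Rightarrow> real ^ 'n" where
  "AG_x f L l x0 0 = x0"
| "AG_w f L l x0 0 = x0"
| "AG_x f L l x0 (Suc k) =
     AG_w f L l x0 k - (1 / L) *\<^sub>R gradient f (AG_w f L l x0 k)"
| "AG_w f L l x0 (Suc k) =
     AG_x f L l x0 (Suc k) +
     ((sqrt (cond_number L l) - 1) / (sqrt (cond_number L l) + 1)) *\<^sub>R
       (AG_x f L l x0 (Suc k) - AG_x f L l x0 k)"
  by pat_completeness auto
termination
  by (relation "Wellfounded.measure (\<lambda>p. case p of Inl (_, _, _, _, k) \<Rightarrow> 2 * k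
                                     | Inr (_, _, _, _, k) \<Rightarrow> 2 * k + 1)") auto

(* sqrt is extended to negative reals as an odd function; for smooth, strongly convex f
   the radicand below is nonnegative, so this extension plays no role there. *)
primrec AG_sigma ::
  "(real ^ 'n \<Rightarrow> real) \<Rightarrow> real \<Rightarrow> real \<Rightarrow> real ^ 'n \<Rightarrow> nat \<Rightarrow> real" where
  "AG_sigma f L l x0 0 = sqrt 2 * norm (gradient f x0) / l"
| "AG_sigma f L l x0 (Suc k) =
     (let \<kappa> = cond_number L l;
          x = AG_x f L l x0;
          w = AG_w f L l x0
      in sqrt ((1 - \<kappa> powr (-1/2)) * (AG_sigma f L l x0 k)\<^sup>2
               + 2 * (f (x (Suc k)) - f (w k)) / l
               + (norm (gradient f (w k)))\<^sup>2 / (L * l)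
               - (\<kappa> powr (1/2) - \<kappa> powr (-1/2)) * (norm (w k - x k))\<^sup>2))"

end

(* With s = sqrt kappa, z_k = w_k + s (w_k - x_k) and the minimizer p of f, the potential
   V_k = |z_k - p|^2 + 2 (f x_k - f p) / l satisfies the recursion that defines sigma_k^2 with
   "\<le>" in place of "=": adding strong convexity at w_k towards x_k with weight 1 - 1/s to strong
   convexity at w_k towards p with weight 1/s leaves an identity of quadratic forms.
   As V_0 \<le> sigma_0^2, the radicand defining sigma_k is at least V_k \<ge> 0, so the square root may be
   removed; the claimed decrease is then the descent inequality for one gradient step. *)
theory Submission
  imports Defs
begin

lemma smooth_strongly_convexD:
  assumes "smooth_strongly_convex f L l"
  shows "0 < l" and "l \<le> L"
    and "f differentiable (at x)"
    and "l * (norm (x - y))\<^sup>2 / 2 \<le> f y - f x - gradient f x \<bullet> (y - x)"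
    and "f y - f x - gradient f x \<bullet> (y - x) \<le> L * (norm (x - y))\<^sup>2 / 2"
  using assms unfolding smooth_strongly_convex_def by blast+

text \<open>The step length \<open>1 / L\<close> minimizes the quadratic upper bound along the
  negative gradient: the linear term contributes \<open>- (norm g)\<^sup>2 / L\<close>, and the
  quadratic term gives half of it back.\<close>

lemma gradient_step_descent:
  assumes "smooth_strongly_convex f L l"
  shows "f (x - (1 / L) *\<^sub>R gradient f x) - f x \<le> - (norm (gradient f x))\<^sup>2 / (2 * L)"
proof -
  define g where "g = gradient f x"
  have L: "L > 0"
    using smooth_strongly_convexD(1,2)[OF assms] by simp
  have "f (x - (1 / L) *\<^sub>R g) - f x + (norm g)\<^sup>2 / L \<le> L * (norm g / L)\<^sup>2 / 2"
    using smooth_strongly_convexD(5)[OF assms, of "x - (1 / L) *\<^sub>R g" x] L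
    by (simp add: g_def power2_norm_eq_inner)
  also have "\<dots> = (norm g)\<^sup>2 / L - (norm g)\<^sup>2 / (2 * L)"
    using L by (simp add: field_simps power2_eq_square)
  finally show ?thesis
    by (simp add: g_def)
qed

text \<open>Strong convexity at 0 together with Cauchy-Schwarz gives \<open>f y \<ge> f 0\<close>
  outside the ball of radius \<open>2 * norm g / l\<close>, so the minimum over this compact ball is
  global.\<close>

lemma smooth_strongly_convex_minimizer:
  fixes f :: "real ^ 'n \<Rightarrow> real"
  assumes "smooth_strongly_convex f L l"
  obtains p where "\<And>y. f p \<le> f y"
proof -
  note D = smooth_strongly_convexD[OF assms]
  define g where "g = gradient f 0"
  define B where "B = cball (0 :: real ^ 'n) (2 * norm g / l)"
  have "continuous_on B f"
    by (meson D(3) continuous_at_imp_continuous_on differentiable_imp_continuous_within)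
  moreover have "compact B" "0 \<in> B"
    using D(1) by (auto simp: B_def)
  ultimately obtain p where p: "p \<in> B" "\<And>y. y \<in> B \<Longrightarrow> f p \<le> f y"
    by (metis continuous_attains_inf empty_iff)
  have "f p \<le> f y" for y
  proof (cases "y \<in> B")
    case False
    then have "l * norm y > 2 * norm g"
      using D(1) by (simp add: B_def field_simps)
    then have "norm y * (2 * norm g) \<le> norm y * (l * norm y)"
      by (intro mult_left_mono) auto
    moreover have "\<bar>g \<bullet> y\<bar> \<le> norm g * norm y"
      by (rule Cauchy_Schwarz_ineq2)
    moreover have "l * (norm y)\<^sup>2 / 2 \<le> f y - f 0 - g \<bullet> y"
      using D(4)[of 0 y] by (simp add: g_def)
    ultimately have "f 0 \<le> f y"
      by (simp add: power2_eq_square algebra_simps)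
    then show ?thesis
      using p(2)[OF \<open>0 \<in> B\<close>] by simp
  qed (rule p)
  then show ?thesis
    using that by blast
qed

text \<open>With a nonzero gradient at \<open>p\<close>, a gradient step from \<open>p\<close> would
  take \<open>f\<close> below \<open>f p\<close>.\<close>

lemma gradient_minimizer_eq_0:
  assumes "smooth_strongly_convex f L l" and "\<And>y. f p \<le> f y"
  shows "gradient f p = 0"
proof -
  have "L > 0"
    using smooth_strongly_convexD(1,2)[OF assms(1)] by simp
  moreover have "0 \<le> - (norm (gradient f p))\<^sup>2 / (2 * L)"
    using gradient_step_descent[OF assms(1), of p] assms(2)[of "p - (1 / L) *\<^sub>R gradient f p"]
    by simp
  ultimately show ?thesis
    by (simp add: divide_le_0_iff)
qed

text \<open>This is the base case of the comparison of the potential with \<open>AG_sigma\<close>.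
  Strong convexity at \<open>x\<close> bounds the left side by \<open>2 * g * d / l\<close>; added
  to strong convexity at \<open>p\<close>, where the gradient vanishes, it also yields
  \<open>l * d \<le> g\<close>.\<close>

lemma minimizer_potential_le_gradient:
  assumes "smooth_strongly_convex f L l" and min: "\<And>y. f p \<le> f y"
  shows "(norm (x - p))\<^sup>2 + 2 * (f x - f p) / l \<le> 2 * (norm (gradient f x))\<^sup>2 / l\<^sup>2"
proof -
  note D = smooth_strongly_convexD[OF assms(1)]
  define g where "g = norm (gradient f x)"
  define d where "d = norm (x - p)"
  have "- gradient f x \<bullet> (p - x) = gradient f x \<bullet> (x - p)"
    by (simp add: inner_diff_right)
  also have "\<dots> \<le> g * d"
    unfolding g_def d_def by (rule norm_cauchy_schwarz)
  finally have upper: "f x - f p \<le> g * d - l * d\<^sup>2 / 2"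
    using D(4)[of x p] by (simp add: d_def)
  moreover have "l * d\<^sup>2 / 2 \<le> f x - f p"
    using D(4)[of p x] gradient_minimizer_eq_0[OF assms] by (simp add: d_def norm_minus_commute)
  ultimately have "d * (l * d) \<le> d * g"
    by (simp add: power2_eq_square algebra_simps)
  then have ld: "l * d \<le> g"
    by (cases "d = 0") (auto simp: d_def g_def mult_le_cancel_left)
  have "l\<^sup>2 * (d\<^sup>2 + 2 * (f x - f p) / l) = l * (l * d\<^sup>2 + 2 * (f x - f p))"
    using D(1) by (simp add: field_simps power2_eq_square)
  also have "\<dots> \<le> l * (2 * (g * d))"
    using upper D(1) by (intro mult_left_mono) auto
  also have "\<dots> = 2 * (g * (l * d))"
    by simp
  also have "\<dots> \<le> 2 * (g * g)"
    using ld by (intro mult_left_mono) (auto simp: g_def)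
  finally show ?thesis
    using D(1) by (simp add: g_def d_def field_simps power2_eq_square)
qed

text \<open>The coefficients of \<open>u \<bullet> u\<close>, \<open>u \<bullet> v\<close> and
  \<open>v \<bullet> v\<close> agree. With \<open>u = w - p\<close> and \<open>v = w - x\<close>,
  the two middle terms are the quadratic terms of the weighted strong convexity
  inequalities.\<close>

lemma accelerated_quadratic_identity:
  fixes u v :: "'a :: real_inner" and s :: real
  assumes "s \<noteq> 0"
  shows "(norm (u + (s - 1) *\<^sub>R v))\<^sup>2
    = (1 - 1 / s) * (norm (u + s *\<^sub>R v))\<^sup>2 + (1 - 1 / s) * (norm v)\<^sup>2
        + (1 / s) * (norm u)\<^sup>2 - (s - 1 / s) * (norm v)\<^sup>2"
  using assms
  by (simp add: power2_norm_eq_inner inner_add_left inner_add_right inner_diff_left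
      inner_diff_right inner_commute[of v u] field_simps)

text \<open>The vector \<open>s *\<^sub>R x' - (s - 1) *\<^sub>R x\<close> is the next z, written
  without the next w.\<close>

lemma accelerated_step_potential:
  fixes f :: "real ^ 'n \<Rightarrow> real" and w x p :: "real ^ 'n"
  assumes "smooth_strongly_convex f L l" and s: "s = sqrt (L / l)"
  defines "x' \<equiv> w - (1 / L) *\<^sub>R gradient f w"
  shows "(norm (s *\<^sub>R x' - (s - 1) *\<^sub>R x - p))\<^sup>2 + 2 * (f x' - f p) / l
    \<le> (1 - 1 / s) * ((norm (w + s *\<^sub>R (w - x) - p))\<^sup>2 + 2 * (f x - f p) / l)
        + 2 * (f x' - f w) / l + (norm (gradient f w))\<^sup>2 / (L * l)
        - (s - 1 / s) * (norm (w - x))\<^sup>2"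
proof -
  note D = smooth_strongly_convexD[OF assms(1)]
  have s2: "s\<^sup>2 = L / l"
    using D(1,2) by (simp add: s)
  have s1: "1 \<le> s"
    using D(1,2) by (simp add: s)
  have L: "L = s\<^sup>2 * l"
    using D(1) s2 by (simp add: field_simps)
  define g where "g = gradient f w"
  define u where "u = w - p"
  define v where "v = w - x"
  have z: "w + s *\<^sub>R v - p = u + s *\<^sub>R v"
    by (simp add: u_def v_def)
  have sL: "s / L = 1 / (s * l)"
    using s1 D(1) by (simp add: L power2_eq_square)
  have z': "s *\<^sub>R x' - (s - 1) *\<^sub>R x - p = (u + (s - 1) *\<^sub>R v) - (1 / (s * l)) *\<^sub>R g"
    unfolding sL[symmetric] by (simp add: x'_def u_def v_def g_def algebra_simps)
  have "(norm ((u + (s - 1) *\<^sub>R v) - (1 / (s * l)) *\<^sub>R g))\<^sup>2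
      = (norm (u + (s - 1) *\<^sub>R v))\<^sup>2 - 2 / (s * l) * (g \<bullet> (u + (s - 1) *\<^sub>R v))
          + (norm g)\<^sup>2 / (s * l)\<^sup>2"
    unfolding power2_norm_eq_inner
    by (simp add: inner_diff_left inner_diff_right inner_commute power2_eq_square)
  \<comment> \<open>Dividing \<open>u + (s - 1) *\<^sub>R v\<close> by \<open>s\<close> gives a
    convex combination of \<open>u\<close> and \<open>v\<close>; its weights are those used for
    strong convexity towards \<open>p\<close> and \<open>x\<close>.\<close>
  also have "2 / (s * l) * (g \<bullet> (u + (s - 1) *\<^sub>R v))
      = (2 / l) * ((1 / s) * (g \<bullet> u) + (1 - 1 / s) * (g \<bullet> v))"
    using s1 D(1) by (simp add: inner_add_right inner_diff_right field_simps)
  also have "(s * l)\<^sup>2 = L * l"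
    by (simp add: L power2_eq_square)
  finally have expand: "(norm (s *\<^sub>R x' - (s - 1) *\<^sub>R x - p))\<^sup>2
      = (norm (u + (s - 1) *\<^sub>R v))\<^sup>2 - (2 / l) * ((1 / s) * (g \<bullet> u) + (1 - 1 / s) * (g \<bullet> v))
          + (norm g)\<^sup>2 / (L * l)"
    by (simp add: z')
  have strong: "(norm (w - y))\<^sup>2 - (2 / l) * (g \<bullet> (w - y)) \<le> (2 / l) * (f y - f w)" for y
  proof -
    have "(2 / l) * (l * (norm (w - y))\<^sup>2 / 2 - g \<bullet> (w - y)) \<le> (2 / l) * (f y - f w)"
      using D(4)[of w y] D(1) by (intro mult_left_mono) (auto simp: g_def inner_diff_right)
    then show ?thesis
      using D(1) by (simp add: right_diff_distrib)
  qed
  have cu: "(1 / s) * ((norm u)\<^sup>2 - (2 / l) * (g \<bullet> u)) \<le> (1 / s) * ((2 / l) * (f p - f w))"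
    using s1 strong[of p] by (intro mult_left_mono) (auto simp: u_def)
  have cv: "(1 - 1 / s) * ((norm v)\<^sup>2 - (2 / l) * (g \<bullet> v))
      \<le> (1 - 1 / s) * ((2 / l) * (f x - f w))"
    using s1 strong[of x] by (intro mult_left_mono) (auto simp: v_def)
  have q: "(norm (u + (s - 1) *\<^sub>R v))\<^sup>2
      = (1 - 1 / s) * (norm (u + s *\<^sub>R v))\<^sup>2 + (1 - 1 / s) * (norm v)\<^sup>2
        + (1 / s) * (norm u)\<^sup>2 - (s - 1 / s) * (norm v)\<^sup>2"
    using s1 by (intro accelerated_quadratic_identity) auto
  have div: "2 * a / l = (2 / l) * a" for a
    by simp
  \<comment> \<open>In the sum of \<open>cu\<close> and \<open>cv\<close> the inner products with
    \<open>g\<close> cancel, and the function values combine with \<open>f x' - f p\<close> to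
    \<open>(1 - 1 / s) * (f x - f p) + (f x' - f w)\<close>.\<close>
  show ?thesis
    unfolding expand v_def[symmetric] z q div g_def[symmetric]
    using cu cv by (simp only: algebra_simps mult_1_left mult_1_right)
qed

lemma cond_number_powr:
  assumes "0 < l" "l \<le> L"
  shows "cond_number L l powr (1/2) = sqrt (L / l)"
    and "cond_number L l powr (-1/2) = 1 / sqrt (L / l)"
  using assms powr_minus_divide[of "L / l" "1/2"]
  by (simp_all add: cond_number_def powr_half_sqrt)

lemma AG_potential_recursion:
  fixes f :: "real ^ 'n \<Rightarrow> real" and x0 p :: "real ^ 'n"
  assumes "smooth_strongly_convex f L l"
  defines "s \<equiv> sqrt (L / l)" and "x \<equiv> AG_x f L l x0" and "w \<equiv> AG_w f L l x0"
  defines "V \<equiv> \<lambda>k. (norm (w k + s *\<^sub>R (w k - x k) - p))\<^sup>2 + 2 * (f (x k) - f p) / l"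
  shows "V (Suc k) \<le> (1 - 1 / s) * V k + 2 * (f (x (Suc k)) - f (w k)) / l
      + (norm (gradient f (w k)))\<^sup>2 / (L * l) - (s - 1 / s) * (norm (w k - x k))\<^sup>2"
proof -
  have s0: "0 \<le> s"
    using smooth_strongly_convexD(1,2)[OF assms(1)] by (simp add: s_def)
  have xs: "x (Suc k) = w k - (1 / L) *\<^sub>R gradient f (w k)"
    by (simp add: x_def w_def)
  have ws: "w (Suc k) = x (Suc k) + ((s - 1) / (s + 1)) *\<^sub>R (x (Suc k) - x k)"
    by (simp add: x_def w_def s_def cond_number_def)
  \<comment> \<open>The momentum coefficient is chosen so that its product with \<open>1 + s\<close>
    is \<open>s - 1\<close>, which brings the next z into the form required by the one-step
    bound.\<close>
  have "w (Suc k) + s *\<^sub>R (w (Suc k) - x (Suc k))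
      = x (Suc k) + ((1 + s) * ((s - 1) / (s + 1))) *\<^sub>R (x (Suc k) - x k)"
    unfolding ws scaleR_scaleR[symmetric] scaleR_add_left scaleR_one by simp
  also have "(1 + s) * ((s - 1) / (s + 1)) = s - 1"
    using s0 by (simp add: field_simps)
  also have "x (Suc k) + (s - 1) *\<^sub>R (x (Suc k) - x k) = s *\<^sub>R x (Suc k) - (s - 1) *\<^sub>R x k"
    by (simp add: algebra_simps)
  finally show ?thesis
    using accelerated_step_potential[OF assms(1) s_def[THEN meta_eq_to_obj_eq], of "w k" "x k" p]
    by (simp add: V_def xs)
qed

theorem theorem10:
  fixes f :: "real ^ 'n \<Rightarrow> real" and L l :: real and x0 :: "real ^ 'n" and k :: nat
  assumes "smooth_strongly_convex f L l"
  shows "(AG_sigma f L l x0 (Suc k))\<^sup>2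
           \<le> (1 - cond_number L l powr (-1/2)) * (AG_sigma f L l x0 k)\<^sup>2"
proof -
  note D = smooth_strongly_convexD[OF assms]
  obtain p where p: "\<And>y. f p \<le> f y"
    using smooth_strongly_convex_minimizer[OF assms] by blast
  define s where "s = sqrt (L / l)"
  define x where "x = AG_x f L l x0"
  define w where "w = AG_w f L l x0"
  define \<sigma> where "\<sigma> = AG_sigma f L l x0"
  define V where "V k = (norm (w k + s *\<^sub>R (w k - x k) - p))\<^sup>2 + 2 * (f (x k) - f p) / l" for k
  \<comment> \<open>\<open>R k\<close> is the radicand of \<open>\<sigma> (Suc k)\<close>, with the
    powers of kappa expressed through \<open>s\<close>.\<close>
  define R where "R k = (1 - 1 / s) * (\<sigma> k)\<^sup>2 + 2 * (f (x (Suc k)) - f (w k)) / l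
      + (norm (gradient f (w k)))\<^sup>2 / (L * l) - (s - 1 / s) * (norm (w k - x k))\<^sup>2" for k
  have s1: "1 \<le> s"
    using D(1,2) by (simp add: s_def)
  have \<sigma>_Suc: "\<sigma> (Suc k) = sqrt (R k)" for k
    unfolding \<sigma>_def R_def x_def w_def s_def AG_sigma.simps Let_def cond_number_powr[OF D(1,2)] ..
  have V_nonneg: "0 \<le> V k" for k
    using p D(1) by (simp add: V_def)
  have V_le_R: "V (Suc k) \<le> R k" if "V k \<le> (\<sigma> k)\<^sup>2" for k
  proof -
    have "(1 - 1 / s) * V k \<le> (1 - 1 / s) * (\<sigma> k)\<^sup>2"
      using that s1 by (intro mult_left_mono) auto
    then show ?thesis
      using AG_potential_recursion[OF assms, of x0 k p]
      unfolding V_def R_def s_def x_def w_def by linarith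
  qed
  have V_le: "V k \<le> (\<sigma> k)\<^sup>2" for k
  proof (induction k)
    case 0
    \<comment> \<open>Since \<open>w 0 = x 0\<close>, the extrapolation term of \<open>V 0\<close>
      vanishes.\<close>
    show ?case
      using minimizer_potential_le_gradient[OF assms p, of x0]
      by (simp add: V_def \<sigma>_def x_def w_def power_divide power_mult_distrib)
  next
    case (Suc k)
    then show ?case
      using V_le_R[OF Suc] V_nonneg[of "Suc k"] by (simp add: \<sigma>_Suc)
  qed
  have "0 \<le> R k"
    using V_le_R[OF V_le] V_nonneg order_trans by blast
  then have "(\<sigma> (Suc k))\<^sup>2 = R k"
    by (simp add: \<sigma>_Suc)
  also have "\<dots> \<le> (1 - 1 / s) * (\<sigma> k)\<^sup>2"
  proof -
    have "f (x (Suc k)) - f (w k) \<le> - (norm (gradient f (w k)))\<^sup>2 / (2 * L)"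
      using gradient_step_descent[OF assms, of "w k"] by (simp add: x_def w_def)
    then have "2 * (f (x (Suc k)) - f (w k)) / l \<le> 2 * (- (norm (gradient f (w k)))\<^sup>2 / (2 * L)) / l"
      using D(1) by (intro divide_right_mono mult_left_mono) auto
    \<comment> \<open>The descent bound exactly offsets the squared gradient term of the
      radicand.\<close>
    then have "2 * (f (x (Suc k)) - f (w k)) / l + (norm (gradient f (w k)))\<^sup>2 / (L * l) \<le> 0"
      by simp
    moreover have "1 / s \<le> s"
      using s1 order_trans[of "1 / s" 1 s] by simp
    then have "0 \<le> (s - 1 / s) * (norm (w k - x k))\<^sup>2"
      by simp
    ultimately show ?thesis
      unfolding R_def by linarith
  qed
  finally show ?thesis
    by (simp only: \<sigma>_def s_def cond_number_powr[OF D(1,2)])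
qed

end
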